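(* Let $X$ be a set with $|X|>\mathfrak{c}$, where $\mathfrak c=2^{\aleph_0}$. Let $S_X$ be the symmetric group on $X$ equipped with the group topology $\tau_{\mathfrak c}$, let $a\in X$, and let $H=\mathrm{St}_a=\{f\in S_X: f(a)=a\}$. Then the pair $(S_X,H)$ gives a negative answer to the generalization of Itzkowitz's question to factor-spaces: every left uniformly continuous function $S_X/H\to\mathbb{R}$ is right uniformly continuous and every right uniformly continuous function $S_X/H\to\mathbb{R}$ is left uniformly continuous, yet $\mathcal{U}_l(S_X/H)\neq\mathcal{U}_r(S_X/H)$.
   Context: For a topological group $G$, the left uniformity $\mathcal{U}_l(G)$ has as a basis the entourages $V_l=\{(x,y)\in G\times G: x^{-1}y\in V\}$, and the right uniformity $\mathcal{U}_r(G)$ has as a basis the entourages $V_r=\{(x,y)\in G\times G: xy^{-1}\in V\}$, where $V$ runs over neighborhoods of the identity. For a subgroup $H$ of $G$, let $G/H=\{gH:g\in G\}$ and let $\pi:G\to G/H$ be the quotient map $g\mapsto gH$. The left uniform structure $\mathcal{U}_l(G/H)$ (respectively the right uniform structure $\mathcal{U}_r(G/H)$) is the finest uniformity on $G/H$ such that $\pi:(G,\mathcal{U}_l(G))\to G/H$ (respectively $\pi:(G,\mathcal{U}_r(G))\to G/H$) is uniformly continuous. These uniformities are not required a priori to be compatible with the quotient topology. A function $G/H\to\mathbb{R}$ is left (respectively right) uniformly continuous if it is uniformly continuous with respect to $\mathcal{U}_l(G/H)$ (respectively $\mathcal{U}_r(G/H)$) and the usual additive uniformity on $\mathbb{R}$.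 The generalization of Itzkowitz's question to factor-spaces asks: do $\mathcal{U}_l(G/H)$ and $\mathcal{U}_r(G/H)$ coincide as soon as every left uniformly continuous real-valued function on $G/H$ is right uniformly continuous? For a set $X$, $S_X$ is the group of all bijections of $X$ onto itself (under composition). For a partition $\gamma$ of $X$, $\mathrm{St}_\gamma=\{f\in S_X: f(B)=B \text{ for all } B\in\gamma\}$. The topology $\tau_{\mathfrak c}$ on $S_X$ is the group topology for which the subgroups $\mathrm{St}_\gamma$, with $\gamma$ running over all partitions of $X$ with $|\gamma|\le\mathfrak c$, form a basis of neighborhoods of the identity. *)

theory Defs
  imports "HOL-Analysis.Analysis" "HOL-Algebra.Bij" "HOL-Algebra.Left_Coset"
begin

section \<open>Uniformities on a carrier set\<close>

text \<open>
  A uniformity on a set \<open>Y\<close> is the filter of its entourages. The three conditions after the first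
  are the axioms of the class \<^class>\<open>uniform_space\<close>, relativised to \<open>Y\<close>. In the order of filters,
  \<open>U \<le> W\<close> means that \<open>U\<close> has more entourages, so smaller filters are finer uniformities.
\<close>

definition is_uniformity :: "'b set \<Rightarrow> ('b \<times> 'b) filter \<Rightarrow> bool" where
  "is_uniformity Y U \<longleftrightarrow>
     U \<le> principal (Y \<times> Y) \<and>
     (\<forall>E. eventually E U \<longrightarrow> (\<forall>x\<in>Y. E (x, x))) \<and>
     (\<forall>E. eventually E U \<longrightarrow> eventually (\<lambda>(x, y). E (y, x)) U) \<and>
     (\<forall>E. eventually E U \<longrightarrow>
        (\<exists>D. eventually D U \<and> (\<forall>x y z. D (x, y) \<longrightarrow> D (y, z) \<longrightarrow> E (x, z))))"

definition uniformly_continuous_wrt ::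
    "('a \<times> 'a) filter \<Rightarrow> ('b \<times> 'b) filter \<Rightarrow> ('a \<Rightarrow> 'b) \<Rightarrow> bool" where
  "uniformly_continuous_wrt U W f \<longleftrightarrow> filterlim (\<lambda>(x, y). (f x, f y)) W U"

definition final_uniformity ::
    "('a \<times> 'a) filter \<Rightarrow> 'b set \<Rightarrow> ('a \<Rightarrow> 'b) \<Rightarrow> ('b \<times> 'b) filter" where
  "final_uniformity U Y p = (LEAST W. is_uniformity Y W \<and> uniformly_continuous_wrt U W p)"

lemma is_uniformity_refl:
  assumes "is_uniformity Y U" "eventually E U" "x \<in> Y"
  shows "E (x, x)"
proof -
  have "\<forall>E. eventually E U \<longrightarrow> (\<forall>x\<in>Y. E (x, x))"
    using assms(1) unfolding is_uniformity_def by (elim conjE)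
  from this[THEN spec[where x = E]] show ?thesis
    using assms(2,3) by simp
qed

lemma is_uniformity_sym:
  assumes "is_uniformity Y U" "eventually E U"
  shows "eventually (\<lambda>(x, y). E (y, x)) U"
  using assms by (simp add: is_uniformity_def)

lemma is_uniformity_trans:
  assumes "is_uniformity Y U" "eventually E U"
  obtains D where "eventually D U" "\<And>x y z. D (x, y) \<Longrightarrow> D (y, z) \<Longrightarrow> E (x, z)"
proof -
  have "\<exists>D. eventually D U \<and> (\<forall>x y z. D (x, y) \<longrightarrow> D (y, z) \<longrightarrow> E (x, z))"
    using assms by (simp add: is_uniformity_def)
  then show thesis
    using that by blast
qed

lemma is_uniformity_inf:
  assumes "is_uniformity Y U" "is_uniformity Y W"
  shows "is_uniformity Y (inf U W)"
  unfolding is_uniformity_def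
proof (intro conjI allI impI)
  show "inf U W \<le> principal (Y \<times> Y)"
    using assms by (auto simp: is_uniformity_def intro: le_infI1)
next
  fix E assume E: "eventually E (inf U W)"
  then obtain P Q where P: "eventually P U" and Q: "eventually Q W"
    and PQ: "\<And>x. P x \<Longrightarrow> Q x \<Longrightarrow> E x"
    by (auto simp: eventually_inf)
  show "\<forall>x\<in>Y. E (x, x)"
    using PQ is_uniformity_refl[OF assms(1) P] is_uniformity_refl[OF assms(2) Q] by simp
  have "eventually (\<lambda>(x, y). P (y, x)) U" "eventually (\<lambda>(x, y). Q (y, x)) W"
    using is_uniformity_sym[OF assms(1) P] is_uniformity_sym[OF assms(2) Q] by simp_all
  then show "eventually (\<lambda>(x, y). E (y, x)) (inf U W)"
    unfolding eventually_inf using PQ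
    by (intro exI[of _ "\<lambda>(x, y). P (y, x)"] exI[of _ "\<lambda>(x, y). Q (y, x)"]) simp
  obtain P' where P': "eventually P' U" "\<And>x y z. P' (x, y) \<Longrightarrow> P' (y, z) \<Longrightarrow> P (x, z)"
    using is_uniformity_trans[OF assms(1) P] by blast
  obtain Q' where Q': "eventually Q' W" "\<And>x y z. Q' (x, y) \<Longrightarrow> Q' (y, z) \<Longrightarrow> Q (x, z)"
    using is_uniformity_trans[OF assms(2) Q] by blast
  have "eventually (\<lambda>x. P' x \<and> Q' x) (inf U W)"
    unfolding eventually_inf using P'(1) Q'(1) by blast
  then show "\<exists>D. eventually D (inf U W) \<and> (\<forall>x y z. D (x, y) \<longrightarrow> D (y, z) \<longrightarrow> E (x, z))"
  proof (intro exI[of _ "\<lambda>x. P' x \<and> Q' x"] conjI allI impI)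
    fix x y z assume "P' (x, y) \<and> Q' (x, y)" "P' (y, z) \<and> Q' (y, z)"
    then show "E (x, z)"
      by (intro PQ P'(2)[of x y z] Q'(2)[of x y z]) simp_all
  qed
qed

lemma is_uniformity_Inf_finite:
  assumes "finite S" "S \<noteq> {}" "\<forall>U\<in>S. is_uniformity Y U"
  shows "is_uniformity Y (Inf S)"
  using assms by (induction S rule: finite_ne_induct) (simp_all add: is_uniformity_inf)

lemma is_uniformity_Inf:
  assumes "S \<noteq> {}" "\<forall>U\<in>S. is_uniformity Y U"
  shows "is_uniformity Y (Inf S)"
proof -
  obtain U0 where U0: "U0 \<in> S"
    using assms(1) by blast
  have fin: "\<exists>F. is_uniformity Y F \<and> Inf S \<le> F \<and> eventually E F"
    if "eventually E (Inf S)" for E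
  proof -
    obtain B where B: "B \<subseteq> S" "finite B" "eventually E (Inf B)"
      using iffD1[OF eventually_Inf \<open>eventually E (Inf S)\<close>] by auto
    have "is_uniformity Y (Inf (insert U0 B))"
      using B(1,2) U0 assms(2) by (intro is_uniformity_Inf_finite) (simp_all add: subset_iff)
    moreover have "Inf S \<le> Inf (insert U0 B)"
      using B(1) U0 by (intro Inf_superset_mono) simp
    moreover have "eventually E (Inf (insert U0 B))"
      by (rule filter_leD[OF _ B(3)]) simp
    ultimately show ?thesis
      by (intro exI conjI)
  qed
  show ?thesis
    unfolding is_uniformity_def
  proof (intro conjI allI impI)
    show "Inf S \<le> principal (Y \<times> Y)"
      by (rule Inf_lower2[OF U0]) (use U0 assms(2) in \<open>simp add: is_uniformity_def\<close>)
  next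
    fix E assume "eventually E (Inf S)"
    then obtain F where F: "is_uniformity Y F" "Inf S \<le> F" "eventually E F"
      using fin by blast
    show "\<forall>x\<in>Y. E (x, x)"
      using is_uniformity_refl[OF F(1,3)] by simp
    show "eventually (\<lambda>(x, y). E (y, x)) (Inf S)"
      using is_uniformity_sym[OF F(1,3)] by (rule filter_leD[OF F(2)])
    show "\<exists>D. eventually D (Inf S) \<and> (\<forall>x y z. D (x, y) \<longrightarrow> D (y, z) \<longrightarrow> E (x, z))"
      using is_uniformity_trans[OF F(1,3)] filter_leD[OF F(2)] by metis
  qed
qed

text \<open>The final uniformity exists, so \<open>LEAST\<close> in its definition denotes it.\<close>

lemma final_uniformity:
  assumes "U \<le> principal (A \<times> A)" "p \<in> A \<rightarrow> Y"
  shows "is_uniformity Y (final_uniformity U Y p)"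
    and "uniformly_continuous_wrt U (final_uniformity U Y p) p"
    and "\<And>W. is_uniformity Y W \<Longrightarrow> uniformly_continuous_wrt U W p \<Longrightarrow> final_uniformity U Y p \<le> W"
proof -
  define S where "S = {W. is_uniformity Y W \<and> uniformly_continuous_wrt U W p}"
  have "is_uniformity Y (principal (Y \<times> Y))"
    unfolding is_uniformity_def eventually_principal
    by (auto intro!: exI[of _ "\<lambda>z. z \<in> Y \<times> Y"])
  moreover have "eventually (\<lambda>z. z \<in> A \<times> A) U"
    using assms(1) by (simp add: le_principal)
  then have "uniformly_continuous_wrt U (principal (Y \<times> Y)) p"
    unfolding uniformly_continuous_wrt_def filterlim_principal
    by (rule eventually_mono) (use assms(2) in auto)
  ultimately have "S \<noteq> {}"
    by (auto simp: S_def)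
  then have "is_uniformity Y (Inf S)"
    by (rule is_uniformity_Inf) (auto simp: S_def)
  moreover have "uniformly_continuous_wrt U (Inf S) p"
    unfolding uniformly_continuous_wrt_def filterlim_def
    by (rule Inf_greatest) (auto simp: S_def uniformly_continuous_wrt_def filterlim_def)
  moreover have "Inf S \<le> W" if "is_uniformity Y W" "uniformly_continuous_wrt U W p" for W
    using that by (auto simp: S_def intro: Inf_lower)
  moreover from calculation have "final_uniformity U Y p = Inf S"
    unfolding final_uniformity_def by (intro Least_equality) auto
  ultimately show "is_uniformity Y (final_uniformity U Y p)"
    and "uniformly_continuous_wrt U (final_uniformity U Y p) p"
    and "\<And>W. is_uniformity Y W \<Longrightarrow> uniformly_continuous_wrt U W p \<Longrightarrow> final_uniformity U Y p \<le> W"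
    by simp_all
qed


section \<open>Left and right uniformities of a topological group and of its coset spaces\<close>

definition topological_group :: "('a, 'm) monoid_scheme \<Rightarrow> 'a topology \<Rightarrow> bool" where
  "topological_group G T \<longleftrightarrow>
     group G \<and> topspace T = carrier G \<and>
     continuous_map (prod_topology T T) T (\<lambda>(x, y). x \<otimes>\<^bsub>G\<^esub> y) \<and>
     continuous_map T T (\<lambda>x. inv\<^bsub>G\<^esub> x)"

definition identity_nhds :: "('a, 'm) monoid_scheme \<Rightarrow> 'a topology \<Rightarrow> 'a set set" where
  "identity_nhds G T = {V. V \<subseteq> topspace T \<and> (\<exists>W. openin T W \<and> \<one>\<^bsub>G\<^esub> \<in> W \<and> W \<subseteq> V)}"

lemma identity_nhds_base:
  assumes "topological_group G T"
  shows "identity_nhds G T \<noteq> {}"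
    and "V \<in> identity_nhds G T \<Longrightarrow> W \<in> identity_nhds G T \<Longrightarrow> V \<inter> W \<in> identity_nhds G T"
proof -
  have "\<one>\<^bsub>G\<^esub> \<in> topspace T"
    using assms by (simp add: topological_group_def group.is_monoid monoid.one_closed)
  then have "topspace T \<in> identity_nhds G T"
    unfolding identity_nhds_def by auto
  then show "identity_nhds G T \<noteq> {}"
    by auto
next
  assume "V \<in> identity_nhds G T" "W \<in> identity_nhds G T"
  then obtain V' W' where "V \<subseteq> topspace T"
    "openin T V'" "\<one>\<^bsub>G\<^esub> \<in> V'" "V' \<subseteq> V" "openin T W'" "\<one>\<^bsub>G\<^esub> \<in> W'" "W' \<subseteq> W"
    by (auto simp: identity_nhds_def)
  then show "V \<inter> W \<in> identity_nhds G T"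
    unfolding identity_nhds_def by (auto intro!: exI[of _ "V' \<inter> W'"])
qed

text \<open>The entourages in the definitions below do form bases of the two filters.\<close>

definition left_uniformity :: "('a, 'm) monoid_scheme \<Rightarrow> 'a topology \<Rightarrow> ('a \<times> 'a) filter" where
  "left_uniformity G T =
     (INF V\<in>identity_nhds G T.
        principal {(x, y). x \<in> carrier G \<and> y \<in> carrier G \<and> inv\<^bsub>G\<^esub> x \<otimes>\<^bsub>G\<^esub> y \<in> V})"

definition right_uniformity :: "('a, 'm) monoid_scheme \<Rightarrow> 'a topology \<Rightarrow> ('a \<times> 'a) filter" where
  "right_uniformity G T =
     (INF V\<in>identity_nhds G T.
        principal {(x, y). x \<in> carrier G \<and> y \<in> carrier G \<and> x \<otimes>\<^bsub>G\<^esub> inv\<^bsub>G\<^esub> y \<in> V})"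

lemma eventually_left_uniformity:
  assumes "topological_group G T"
  shows "eventually E (left_uniformity G T) \<longleftrightarrow>
    (\<exists>V\<in>identity_nhds G T. \<forall>x\<in>carrier G. \<forall>y\<in>carrier G. inv\<^bsub>G\<^esub> x \<otimes>\<^bsub>G\<^esub> y \<in> V \<longrightarrow> E (x, y))"
  unfolding left_uniformity_def
proof (subst eventually_INF_base, goal_cases)
  case (2 V W)
  show ?case
    by (rule bexI[OF _ identity_nhds_base(2)[OF assms 2]]) auto
qed (auto simp: eventually_principal identity_nhds_base(1)[OF assms])

lemma eventually_right_uniformity:
  assumes "topological_group G T"
  shows "eventually E (right_uniformity G T) \<longleftrightarrow>
    (\<exists>V\<in>identity_nhds G T. \<forall>x\<in>carrier G. \<forall>y\<in>carrier G. x \<otimes>\<^bsub>G\<^esub> inv\<^bsub>G\<^esub> y \<in> V \<longrightarrow> E (x, y))"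
  unfolding right_uniformity_def
proof (subst eventually_INF_base, goal_cases)
  case (2 V W)
  show ?case
    by (rule bexI[OF _ identity_nhds_base(2)[OF assms 2]]) auto
qed (auto simp: eventually_principal identity_nhds_base(1)[OF assms])

definition left_quotient_uniformity ::
    "('a, 'm) monoid_scheme \<Rightarrow> 'a topology \<Rightarrow> 'a set \<Rightarrow> ('a set \<times> 'a set) filter" where
  "left_quotient_uniformity G T H =
     final_uniformity (left_uniformity G T) (lcosets\<^bsub>G\<^esub> H) (\<lambda>g. g <#\<^bsub>G\<^esub> H)"

definition right_quotient_uniformity ::
    "('a, 'm) monoid_scheme \<Rightarrow> 'a topology \<Rightarrow> 'a set \<Rightarrow> ('a set \<times> 'a set) filter" where
  "right_quotient_uniformity G T H =
     final_uniformity (right_uniformity G T) (lcosets\<^bsub>G\<^esub> H) (\<lambda>g. g <#\<^bsub>G\<^esub> H)"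

text \<open>
  The quotient uniformities live on the set of left cosets, so the values of \<open>f\<close> at other sets are
  irrelevant below; \<^const>\<open>uniformity\<close> is the usual uniformity of the reals.
\<close>

definition left_uniformly_continuous ::
    "('a, 'm) monoid_scheme \<Rightarrow> 'a topology \<Rightarrow> 'a set \<Rightarrow> ('a set \<Rightarrow> real) \<Rightarrow> bool" where
  "left_uniformly_continuous G T H f \<longleftrightarrow>
     uniformly_continuous_wrt (left_quotient_uniformity G T H) uniformity f"

definition right_uniformly_continuous ::
    "('a, 'm) monoid_scheme \<Rightarrow> 'a topology \<Rightarrow> 'a set \<Rightarrow> ('a set \<Rightarrow> real) \<Rightarrow> bool" where
  "right_uniformly_continuous G T H f \<longleftrightarrow>
     uniformly_continuous_wrt (right_quotient_uniformity G T H) uniformity f"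


section \<open>Group topologies given by subgroups\<close>

definition subgroup_topology :: "('a, 'm) monoid_scheme \<Rightarrow> 'a set set \<Rightarrow> 'a topology" where
  "subgroup_topology G \<N> =
     topology (\<lambda>U. U \<subseteq> carrier G \<and> (\<forall>x\<in>U. \<exists>N\<in>\<N>. x <#\<^bsub>G\<^esub> N \<subseteq> U))"

text \<open>
  For a conjugation-stable filter base of subgroups this is the group topology in which they form
  a basis of neighbourhoods of the identity.
\<close>

locale subgroup_base = group G for G (structure) +
  fixes \<N> :: "'a set set"
  assumes nonempty: "\<N> \<noteq> {}"
    and subgroups: "N \<in> \<N> \<Longrightarrow> subgroup N G"
    and directed: "\<lbrakk>M \<in> \<N>; N \<in> \<N>\<rbrakk> \<Longrightarrow> \<exists>K\<in>\<N>. K \<subseteq> M \<inter> N"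
    and conjugate: "\<lbrakk>N \<in> \<N>; g \<in> carrier G\<rbrakk> \<Longrightarrow> \<exists>K\<in>\<N>. \<forall>k\<in>K. g \<otimes> k \<otimes> inv g \<in> N"
begin

lemma openin_subgroup_topology:
  "openin (subgroup_topology G \<N>) U \<longleftrightarrow> U \<subseteq> carrier G \<and> (\<forall>x\<in>U. \<exists>N\<in>\<N>. x <# N \<subseteq> U)"
proof -
  have "istopology (\<lambda>U. U \<subseteq> carrier G \<and> (\<forall>x\<in>U. \<exists>N\<in>\<N>. x <# N \<subseteq> U))"
    unfolding istopology_def
  proof (rule conjI; intro allI impI)
    fix S T
    assume S: "S \<subseteq> carrier G \<and> (\<forall>x\<in>S. \<exists>N\<in>\<N>. x <# N \<subseteq> S)"
      and T: "T \<subseteq> carrier G \<and> (\<forall>x\<in>T. \<exists>N\<in>\<N>. x <# N \<subseteq> T)"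
    have "\<exists>K\<in>\<N>. x <# K \<subseteq> S \<inter> T" if x: "x \<in> S \<inter> T" for x
    proof -
      obtain M N where M: "M \<in> \<N>" "x <# M \<subseteq> S" and N: "N \<in> \<N>" "x <# N \<subseteq> T"
        using S T x by blast
      obtain K where "K \<in> \<N>" "K \<subseteq> M \<inter> N"
        using directed[OF M(1) N(1)] by blast
      then show ?thesis
        using M N by (intro bexI[of _ K]) (fastforce simp: l_coset_def)+
    qed
    then show "S \<inter> T \<subseteq> carrier G \<and> (\<forall>x\<in>S \<inter> T. \<exists>N\<in>\<N>. x <# N \<subseteq> S \<inter> T)"
      using S by blast
  next
    fix K
    assume "\<forall>U\<in>K. U \<subseteq> carrier G \<and> (\<forall>x\<in>U. \<exists>N\<in>\<N>. x <# N \<subseteq> U)"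
    then show "\<Union> K \<subseteq> carrier G \<and> (\<forall>x\<in>\<Union> K. \<exists>N\<in>\<N>. x <# N \<subseteq> \<Union> K)"
      by (meson UnionE Union_least Union_upper subset_trans)
  qed
  then show ?thesis
    by (simp add: subgroup_topology_def topology_inverse')
qed

lemma topspace_subgroup_topology: "topspace (subgroup_topology G \<N>) = carrier G"
proof -
  have "openin (subgroup_topology G \<N>) (carrier G)"
    unfolding openin_subgroup_topology
  proof (intro conjI ballI)
    fix x assume x: "x \<in> carrier G"
    obtain N where N: "N \<in> \<N>"
      using nonempty by auto
    then show "\<exists>N\<in>\<N>. x <# N \<subseteq> carrier G"
      using l_coset_subset_G[OF subgroup.subset[OF subgroups[OF N]] x] by (intro bexI[of _ N])
  qed simp
  moreover have "topspace (subgroup_topology G \<N>) \<subseteq> carrier G"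
    using openin_topspace[of "subgroup_topology G \<N>"] unfolding openin_subgroup_topology by simp
  ultimately show ?thesis
    by (intro subset_antisym openin_subset)
qed

lemma openin_coset:
  assumes x: "x \<in> carrier G" and N: "N \<in> \<N>"
  shows "openin (subgroup_topology G \<N>) (x <# N)" "x \<in> x <# N"
proof -
  interpret N: subgroup N G using N by (rule subgroups)
  show "x \<in> x <# N"
    using x N.one_closed by (force simp: l_coset_def)
  have "y <# N \<subseteq> x <# N" if "y \<in> x <# N" for y
    using l_repr_independence[OF that x N.subgroup_axioms] by simp
  moreover have "x <# N \<subseteq> carrier G"
    using l_coset_subset_G[OF N.subset x] .
  ultimately show "openin (subgroup_topology G \<N>) (x <# N)"
    unfolding openin_subgroup_topology using N by metis
qed

lemma identity_nhds_subgroup_topology: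
  "V \<in> identity_nhds G (subgroup_topology G \<N>) \<longleftrightarrow> V \<subseteq> carrier G \<and> (\<exists>N\<in>\<N>. N \<subseteq> V)"
proof
  assume "V \<in> identity_nhds G (subgroup_topology G \<N>)"
  then obtain W where V: "V \<subseteq> carrier G" and W: "openin (subgroup_topology G \<N>) W" "\<one> \<in> W" "W \<subseteq> V"
    by (auto simp: identity_nhds_def topspace_subgroup_topology)
  then obtain N where "N \<in> \<N>" "\<one> <# N \<subseteq> W"
    unfolding openin_subgroup_topology by blast
  moreover from this have "\<one> <# N = N"
    using lcos_mult_one subgroup.subset subgroups by blast
  ultimately show "V \<subseteq> carrier G \<and> (\<exists>N\<in>\<N>. N \<subseteq> V)"
    using V W(3) by (metis subset_trans)
next
  assume "V \<subseteq> carrier G \<and> (\<exists>N\<in>\<N>. N \<subseteq> V)"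
  then obtain N where V: "V \<subseteq> carrier G" and N: "N \<in> \<N>" "N \<subseteq> V" by blast
  have "\<one> <# N = N"
    using N(1) lcos_mult_one subgroup.subset subgroups by blast
  then show "V \<in> identity_nhds G (subgroup_topology G \<N>)"
    using openin_coset[OF one_closed N(1)] V N(2)
    by (auto simp: identity_nhds_def topspace_subgroup_topology)
qed

lemma topological_group_subgroup_topology: "topological_group G (subgroup_topology G \<N>)"
proof -
  let ?T = "subgroup_topology G \<N>"
  have "continuous_map (prod_topology ?T ?T) ?T (\<lambda>(x, y). x \<otimes> y)"
    unfolding continuous_map
  proof (intro conjI allI impI)
    show "(\<lambda>(x, y). x \<otimes> y) ` topspace (prod_topology ?T ?T) \<subseteq> topspace ?T"
      by (auto simp: topspace_subgroup_topology)
    fix U assume U: "openin ?T U"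
    show "openin (prod_topology ?T ?T)
            {p \<in> topspace (prod_topology ?T ?T). (\<lambda>(x, y). x \<otimes> y) p \<in> U}"
      unfolding openin_prod_topology_alt
    proof (intro allI impI)
      fix x y
      assume "(x, y) \<in> {p \<in> topspace (prod_topology ?T ?T). (\<lambda>(x, y). x \<otimes> y) p \<in> U}"
      then have x: "x \<in> carrier G" and y: "y \<in> carrier G" and xy: "x \<otimes> y \<in> U"
        by (auto simp: topspace_subgroup_topology)
      obtain N where N: "N \<in> \<N>" "x \<otimes> y <# N \<subseteq> U"
        using U xy unfolding openin_subgroup_topology by blast
      obtain K where K: "K \<in> \<N>" "\<And>k. k \<in> K \<Longrightarrow> inv y \<otimes> k \<otimes> y \<in> N"
        using conjugate[OF N(1) inv_closed[OF y]] y by auto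
      interpret N: subgroup N G using N(1) by (rule subgroups)
      interpret K: subgroup K G using K(1) by (rule subgroups)
      have "(x \<otimes> k) \<otimes> (y \<otimes> n) \<in> U" if k: "k \<in> K" and n: "n \<in> N" for k n
      proof -
        have kn: "k \<in> carrier G" "n \<in> carrier G" using k n by auto
        have "(x \<otimes> y) \<otimes> ((inv y \<otimes> k \<otimes> y) \<otimes> n) = x \<otimes> (y \<otimes> (inv y \<otimes> (k \<otimes> (y \<otimes> n))))"
          using x y kn by (simp add: m_assoc)
        also have "\<dots> = x \<otimes> (k \<otimes> (y \<otimes> n))"
          using x y kn by (simp add: m_assoc[symmetric, of y "inv y"])
        also have "\<dots> = (x \<otimes> k) \<otimes> (y \<otimes> n)"
          using x y kn by (simp add: m_assoc)
        finally have eq: "(x \<otimes> y) \<otimes> ((inv y \<otimes> k \<otimes> y) \<otimes> n) = (x \<otimes> k) \<otimes> (y \<otimes> n)" .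
        have "(x \<otimes> y) \<otimes> ((inv y \<otimes> k \<otimes> y) \<otimes> n) \<in> x \<otimes> y <# N"
          unfolding l_coset_def using N.m_closed[OF K(2)[OF k] n] by blast
        then show ?thesis
          using N(2) unfolding eq by (rule subsetD[rotated])
      qed
      then show "\<exists>V W. openin ?T V \<and> openin ?T W \<and> x \<in> V \<and> y \<in> W \<and>
          V \<times> W \<subseteq> {p \<in> topspace (prod_topology ?T ?T). (\<lambda>(x, y). x \<otimes> y) p \<in> U}"
        using openin_coset[OF x K(1)] openin_coset[OF y N(1)] x y
        by (intro exI[of _ "x <# K"] exI[of _ "y <# N"])
           (auto simp: topspace_subgroup_topology l_coset_def)
    qed
  qed
  moreover have "continuous_map ?T ?T (\<lambda>x. inv x)"
    unfolding continuous_map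
  proof (intro conjI allI impI)
    show "(\<lambda>x. inv x) ` topspace ?T \<subseteq> topspace ?T"
      by (auto simp: topspace_subgroup_topology)
    fix U assume U: "openin ?T U"
    have "\<exists>K\<in>\<N>. x <# K \<subseteq> {x \<in> carrier G. inv x \<in> U}" if x: "x \<in> carrier G" "inv x \<in> U" for x
    proof -
      obtain N where N: "N \<in> \<N>" "inv x <# N \<subseteq> U"
        using U x unfolding openin_subgroup_topology by blast
      obtain K where K: "K \<in> \<N>" "\<And>k. k \<in> K \<Longrightarrow> x \<otimes> k \<otimes> inv x \<in> N"
        using conjugate[OF N(1) x(1)] by auto
      interpret K: subgroup K G using K(1) by (rule subgroups)
      have "inv (x \<otimes> k) \<in> U" if k: "k \<in> K" for k
      proof -
        have kc: "k \<in> carrier G" using k by auto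
        have "inv x \<otimes> (x \<otimes> inv k \<otimes> inv x) = inv (x \<otimes> k)"
          using x kc by (simp add: m_assoc[symmetric] inv_mult_group)
        then show ?thesis
          using N(2) K(2)[OF K.m_inv_closed[OF k]] by (force simp: l_coset_def)
      qed
      then show ?thesis
        using K(1) x by (intro bexI[of _ K]) (auto simp: l_coset_def)
    qed
    then show "openin ?T {x \<in> topspace ?T. inv x \<in> U}"
      unfolding openin_subgroup_topology topspace_subgroup_topology by blast
  qed
  ultimately show ?thesis
    by (simp add: topological_group_def topspace_subgroup_topology group_axioms)
qed

end


section \<open>The symmetric group with the topology of stabilizers of small partitions\<close>

definition partition_stabilizer :: "'a set \<Rightarrow> 'a set set \<Rightarrow> ('a \<Rightarrow> 'a) set" where
  "partition_stabilizer X \<gamma> = {f \<in> carrier (BijGroup X). \<forall>B\<in>\<gamma>. f ` B = B}"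

definition point_stabilizer :: "'a set \<Rightarrow> 'a \<Rightarrow> ('a \<Rightarrow> 'a) set" where
  "point_stabilizer X a = {f \<in> carrier (BijGroup X). f a = a}"

text \<open>The cardinal \<open>2\<^sup>\<aleph>\<^sub>0\<close> is represented by the set of all sets of natural numbers.\<close>

definition continuum_topology :: "'a set \<Rightarrow> ('a \<Rightarrow> 'a) topology" where
  "continuum_topology X =
     subgroup_topology (BijGroup X)
       {partition_stabilizer X \<gamma> | \<gamma>. partition_on X \<gamma> \<and> \<gamma> \<lesssim> (UNIV :: nat set set)}"

lemma subgroup_base_continuum:
  "subgroup_base (BijGroup X)
     {partition_stabilizer X \<gamma> | \<gamma>. partition_on X \<gamma> \<and> \<gamma> \<lesssim> (UNIV :: nat set set)}"
proof -
  let ?G = "BijGroup X"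
  interpret group ?G by (rule group_BijGroup)
  have bij: "bij_betw f X X" if "f \<in> carrier ?G" for f
    using that by (simp add: BijGroup_def Bij_def)
  have mult_image: "(f \<otimes>\<^bsub>?G\<^esub> g) ` B = f ` g ` B"
    if "f \<in> carrier ?G" "g \<in> carrier ?G" "B \<subseteq> X" for f g B
    using that by (force simp: BijGroup_def compose_def)
  have one_image: "\<one>\<^bsub>?G\<^esub> ` B = B" if "B \<subseteq> X" for B
    using that by (force simp: BijGroup_def)
  have image_subset: "f ` B \<subseteq> X" if "f \<in> carrier ?G" "B \<subseteq> X" for f B
    using bij[OF that(1)] that(2) by (auto simp: bij_betw_def)
  have part_subset: "B \<subseteq> X" if "partition_on X \<gamma>" "B \<in> \<gamma>" for B \<gamma>
    using that by (auto simp: partition_on_def)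
  have sub: "subgroup (partition_stabilizer X \<gamma>) ?G" if \<gamma>: "partition_on X \<gamma>" for \<gamma>
  proof
    show "partition_stabilizer X \<gamma> \<subseteq> carrier ?G"
      by (auto simp: partition_stabilizer_def)
    show "\<one>\<^bsub>?G\<^esub> \<in> partition_stabilizer X \<gamma>"
      using part_subset[OF \<gamma>] by (simp add: partition_stabilizer_def one_image)
  next
    fix f g assume "f \<in> partition_stabilizer X \<gamma>" "g \<in> partition_stabilizer X \<gamma>"
    then show "f \<otimes>\<^bsub>?G\<^esub> g \<in> partition_stabilizer X \<gamma>"
      using part_subset[OF \<gamma>] by (simp add: partition_stabilizer_def mult_image)
  next
    fix f assume f: "f \<in> partition_stabilizer X \<gamma>"
    then have fc: "f \<in> carrier ?G" by (simp add: partition_stabilizer_def)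
    have "(inv\<^bsub>?G\<^esub> f) ` B = B" if B: "B \<in> \<gamma>" for B
    proof -
      have "(inv\<^bsub>?G\<^esub> f) ` B = (inv\<^bsub>?G\<^esub> f) ` f ` B"
        using f B by (simp add: partition_stabilizer_def)
      also have "\<dots> = B"
        using fc part_subset[OF \<gamma> B] by (simp add: mult_image[symmetric] one_image)
      finally show ?thesis .
    qed
    then show "inv\<^bsub>?G\<^esub> f \<in> partition_stabilizer X \<gamma>"
      using fc by (simp add: partition_stabilizer_def)
  qed
  show ?thesis
  proof (rule subgroup_base.intro[OF group_BijGroup], rule subgroup_base_axioms.intro, goal_cases)
    case 1
    have "partition_on X ({X} - {{}})"
      by (auto simp: partition_on_def disjoint_def)
    moreover have "{X} - {{}} \<lesssim> (UNIV :: nat set set)"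
      unfolding lepoll_def by (intro exI[of _ "\<lambda>_. {}"]) (auto simp: inj_on_def)
    ultimately show ?case by blast
  next
    case (2 N)
    then obtain \<gamma> where "N = partition_stabilizer X \<gamma>" "partition_on X \<gamma>" by auto
    then show ?case using sub by simp
  next
    case (3 M N)
    then obtain \<gamma> \<delta> where M: "M = partition_stabilizer X \<gamma>" and N: "N = partition_stabilizer X \<delta>"
      and \<gamma>: "partition_on X \<gamma>" "\<gamma> \<lesssim> (UNIV :: nat set set)"
      and \<delta>: "partition_on X \<delta>" "\<delta> \<lesssim> (UNIV :: nat set set)"
      by blast
    define \<rho> where "\<rho> = (\<lambda>(B, C). B \<inter> C) ` (\<gamma> \<times> \<delta>) - {{}}"
    have "partition_on X \<rho>"
    proof (rule partition_onI)
      show "\<Union> \<rho> = X"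
      proof
        show "X \<subseteq> \<Union> \<rho>"
        proof
          fix x assume "x \<in> X"
          then obtain B C where "B \<in> \<gamma>" "x \<in> B" "C \<in> \<delta>" "x \<in> C"
            using partition_onD1[OF \<gamma>(1)] partition_onD1[OF \<delta>(1)] by blast
          then show "x \<in> \<Union> \<rho>"
            unfolding \<rho>_def by (intro UnionI[of "B \<inter> C"]) auto
        qed
      qed (use part_subset[OF \<gamma>(1)] in \<open>auto simp: \<rho>_def\<close>)
    next
      fix P Q assume "P \<in> \<rho>" "Q \<in> \<rho>" "P \<noteq> Q"
      then obtain B C B' C' where P: "P = B \<inter> C" "B \<in> \<gamma>" "C \<in> \<delta>"
        and Q: "Q = B' \<inter> C'" "B' \<in> \<gamma>" "C' \<in> \<delta>" and "B \<noteq> B' \<or> C \<noteq> C'"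
        by (auto simp: \<rho>_def)
      moreover have "B = B' \<or> B \<inter> B' = {}" "C = C' \<or> C \<inter> C' = {}"
        using P Q partition_onD2[OF \<gamma>(1)] partition_onD2[OF \<delta>(1)] by (auto dest: disjointD)
      ultimately show "disjnt P Q"
        by (auto simp: disjnt_def)
    qed (auto simp: \<rho>_def)
    moreover have "\<rho> \<lesssim> (UNIV :: nat set set)"
    proof -
      have "infinite (UNIV :: nat set set)"
        by (simp add: Finite_Set.finite_set)
      then have "(UNIV :: nat set set) \<times> (UNIV :: nat set set) \<lesssim> (UNIV :: nat set set)"
        unfolding lepoll_def card_of_ordLeq
        by (intro ordIso_imp_ordLeq card_of_Times_same_infinite)
      then have "\<gamma> \<times> \<delta> \<lesssim> (UNIV :: nat set set)"
        using times_lepoll_mono[OF \<gamma>(2) \<delta>(2)] by (rule lepoll_trans[rotated])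
      moreover have "\<rho> \<lesssim> \<gamma> \<times> \<delta>"
        unfolding \<rho>_def by (rule lepoll_trans[OF subset_imp_lepoll image_lepoll]) auto
      ultimately show ?thesis
        by (rule lepoll_trans[rotated])
    qed
    moreover have "partition_stabilizer X \<rho> \<subseteq> M \<inter> N"
    proof
      fix f assume f: "f \<in> partition_stabilizer X \<rho>"
      then have fc: "f \<in> carrier ?G" and f\<rho>: "\<And>P. P \<in> \<rho> \<Longrightarrow> f ` P = P"
        by (auto simp: partition_stabilizer_def)
      have un: "f ` (\<Union> \<A>) = \<Union> \<A>" if "\<A> \<subseteq> \<rho>" for \<A>
        using f\<rho> that by (simp add: image_Union subset_iff)
      have "f ` B = B" if B: "B \<in> \<gamma>" for B
      proof -
        have "\<exists>P\<in>\<rho>. P \<subseteq> B \<and> x \<in> P" if "x \<in> B" for x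
        proof -
          obtain C where "C \<in> \<delta>" "x \<in> C"
            using \<open>x \<in> B\<close> part_subset[OF \<gamma>(1) B] partition_onD1[OF \<delta>(1)] by blast
          then have "B \<inter> C \<in> \<rho>"
            using B \<open>x \<in> B\<close> by (auto simp: \<rho>_def)
          then show ?thesis
            using \<open>x \<in> B\<close> \<open>x \<in> C\<close> by (intro bexI[of _ "B \<inter> C"]) simp_all
        qed
        then have eq: "\<Union> {P \<in> \<rho>. P \<subseteq> B} = B"
          by (intro equalityI subsetI) (fast, simp add: Bex_def conj_assoc)
        show ?thesis
          using un[of "{P \<in> \<rho>. P \<subseteq> B}"] unfolding eq by simp
      qed
      moreover have "f ` C = C" if C: "C \<in> \<delta>" for C
      proof -
        have "\<exists>P\<in>\<rho>. P \<subseteq> C \<and> x \<in> P" if "x \<in> C" for x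
        proof -
          obtain B where "B \<in> \<gamma>" "x \<in> B"
            using \<open>x \<in> C\<close> part_subset[OF \<delta>(1) C] partition_onD1[OF \<gamma>(1)] by blast
          then have "B \<inter> C \<in> \<rho>"
            using C \<open>x \<in> C\<close> by (auto simp: \<rho>_def)
          then show ?thesis
            using \<open>x \<in> B\<close> \<open>x \<in> C\<close> by (intro bexI[of _ "B \<inter> C"]) simp_all
        qed
        then have eq: "\<Union> {P \<in> \<rho>. P \<subseteq> C} = C"
          by (intro equalityI subsetI) (fast, simp add: Bex_def conj_assoc)
        show ?thesis
          using un[of "{P \<in> \<rho>. P \<subseteq> C}"] unfolding eq by simp
      qed
      ultimately show "f \<in> M \<inter> N"
        using fc by (simp add: M N partition_stabilizer_def)
    qed
    ultimately show ?case by blast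
  next
    case (4 N g)
    then obtain \<gamma> where N: "N = partition_stabilizer X \<gamma>"
      and \<gamma>: "partition_on X \<gamma>" "\<gamma> \<lesssim> (UNIV :: nat set set)"
      by blast
    have g: "g \<in> carrier ?G" "inv\<^bsub>?G\<^esub> g \<in> carrier ?G" using 4 by auto
    define \<delta> where "\<delta> = (`) (inv\<^bsub>?G\<^esub> g) ` \<gamma>"
    have "{} \<notin> \<delta>"
      using \<gamma>(1) by (auto simp: \<delta>_def partition_on_def)
    then have "partition_on X \<delta>"
      using partition_on_inj_image[OF \<gamma>(1), of "inv\<^bsub>?G\<^esub> g"] bij[OF g(2)]
      by (simp add: \<delta>_def bij_betw_def)
    moreover have "\<delta> \<lesssim> (UNIV :: nat set set)"
      unfolding \<delta>_def using image_lepoll \<gamma>(2) by (rule lepoll_trans)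
    moreover have "g \<otimes>\<^bsub>?G\<^esub> k \<otimes>\<^bsub>?G\<^esub> inv\<^bsub>?G\<^esub> g \<in> N" if k: "k \<in> partition_stabilizer X \<delta>" for k
    proof -
      have kc: "k \<in> carrier ?G" using k by (simp add: partition_stabilizer_def)
      have "(g \<otimes>\<^bsub>?G\<^esub> k \<otimes>\<^bsub>?G\<^esub> inv\<^bsub>?G\<^esub> g) ` B = B" if B: "B \<in> \<gamma>" for B
      proof -
        have BX: "B \<subseteq> X" using part_subset[OF \<gamma>(1) B] .
        have "(g \<otimes>\<^bsub>?G\<^esub> k \<otimes>\<^bsub>?G\<^esub> inv\<^bsub>?G\<^esub> g) ` B = g ` k ` (inv\<^bsub>?G\<^esub> g) ` B"
          using g kc BX by (simp add: mult_image image_subset)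
        also have "k ` (inv\<^bsub>?G\<^esub> g) ` B = (inv\<^bsub>?G\<^esub> g) ` B"
          using k B by (auto simp: partition_stabilizer_def \<delta>_def)
        also have "g ` (inv\<^bsub>?G\<^esub> g) ` B = B"
          using g BX by (simp add: mult_image[symmetric] one_image)
        finally show ?thesis .
      qed
      then show ?thesis
        using g kc by (simp add: N partition_stabilizer_def)
    qed
    ultimately show ?case by blast
  qed
qed

lemma topological_group_continuum_topology:
  "topological_group (BijGroup X) (continuum_topology X)"
  unfolding continuum_topology_def
  by (rule subgroup_base.topological_group_subgroup_topology[OF subgroup_base_continuum])

lemma identity_nhds_continuum_topology:
  "V \<in> identity_nhds (BijGroup X) (continuum_topology X) \<longleftrightarrow>
     V \<subseteq> carrier (BijGroup X) \<and>
     (\<exists>\<gamma>. partition_on X \<gamma> \<and> \<gamma> \<lesssim> (UNIV :: nat set set) \<and> partition_stabilizer X \<gamma> \<subseteq> V)"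
  unfolding continuum_topology_def
  by (subst subgroup_base.identity_nhds_subgroup_topology[OF subgroup_base_continuum]) auto

end

theory Submission
  imports Defs
begin

text \<open>
  Evaluation at \<open>a\<close> identifies \<open>S\<^sub>X/H\<close> with \<open>X\<close>. The elements stabilising the partition
  \<open>{{a}, X - {a}}\<close> lie in \<open>H\<close>, so the left uniformity is discrete. The right uniformity is
  generated by the partitions of \<open>X\<close> into at most continuum many blocks; it is not discrete,
  since one of the blocks has two points. But the level sets of a real function form such a
  partition, so every real function is uniformly continuous for both uniformities.
\<close>

section \<open>Uniformities and kernels of functions\<close>

text \<open>The kernel of \<open>f\<close> is an equivalence relation on \<open>Y\<close>, so this
  one entourage is its own inverse and also serves as the witness for composition.\<close>

lemma is_uniformity_kernel:
  "is_uniformity Y (principal {(x, y). x \<in> Y \<and> y \<in> Y \<and> f x = f y})"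
  unfolding is_uniformity_def eventually_principal
  by (auto intro!: exI[of _ "\<lambda>(x, y). x \<in> Y \<and> y \<in> Y \<and> f x = f y"])

text \<open>The final uniformity is below every uniformity making \<open>p\<close> uniformly
  continuous, in particular below the one generated by the kernel of \<open>f\<close>. A check
  upstairs thus settles the quotient without an explicit description of its entourages.\<close>

lemma final_uniformity_le_kernel:
  assumes "U \<le> principal (A \<times> A)" "p \<in> A \<rightarrow> Y"
    and "eventually (\<lambda>(x, y). f (p x) = f (p y)) U"
  shows "eventually (\<lambda>(C, D). f C = f D) (final_uniformity U Y p)"
proof -
  have "eventually (\<lambda>z. z \<in> A \<times> A) U"
    using assms(1) by (simp add: le_principal)
  with assms(3) have "uniformly_continuous_wrt U
      (principal {(C, D). C \<in> Y \<and> D \<in> Y \<and> f C = f D}) p"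
    unfolding uniformly_continuous_wrt_def filterlim_principal
    by eventually_elim (use assms(2) in auto)
  from final_uniformity(3)[OF assms(1,2) is_uniformity_kernel this] show ?thesis
    by (rule filter_leD) (auto simp: eventually_principal)
qed

text \<open>Pairs with equal values land on the diagonal, which every entourage contains.\<close>

lemma uniformly_continuous_wrt_kernel:
  fixes f :: "'a \<Rightarrow> 'b::uniform_space"
  assumes "eventually (\<lambda>(x, y). f x = f y) U"
  shows "uniformly_continuous_wrt U uniformity f"
  unfolding uniformly_continuous_wrt_def filterlim_iff
proof (intro allI impI)
  fix P :: "'b \<times> 'b \<Rightarrow> bool"
  assume "eventually P uniformity"
  then have "P (z, z)" for z
    by (rule uniformity_refl)
  then show "\<forall>\<^sub>F z in U. P (case z of (x, y) \<Rightarrow> (f x, f y))"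
    using assms by (auto elim!: eventually_mono)
qed

lemma left_uniformity_le_principal:
  assumes "topological_group G T"
  shows "left_uniformity G T \<le> principal (carrier G \<times> carrier G)"
  using identity_nhds_base(1)[OF assms]
  by (auto simp: le_principal eventually_left_uniformity[OF assms])

lemma right_uniformity_le_principal:
  assumes "topological_group G T"
  shows "right_uniformity G T \<le> principal (carrier G \<times> carrier G)"
  using identity_nhds_base(1)[OF assms]
  by (auto simp: le_principal eventually_right_uniformity[OF assms])

lemma l_coset_funcset_lcosets: "(\<lambda>g. g <#\<^bsub>G\<^esub> H) \<in> carrier G \<rightarrow> lcosets\<^bsub>G\<^esub> H"
  by (auto simp: LCOSETS_def)

section \<open>Identity neighbourhoods and cosets in the symmetric group\<close>

lemma level_set_stabilizer_in_identity_nhds: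
  assumes "F ` X \<lesssim> (UNIV :: nat set set)"
  shows "{v \<in> carrier (BijGroup X). \<forall>p\<in>X. F (v p) = F p}
    \<in> identity_nhds (BijGroup X) (continuum_topology X)"
proof -
  define \<gamma> where "\<gamma> = (\<lambda>r. {q \<in> X. F q = r}) ` F ` X"
  have "partition_on X \<gamma>"
    unfolding \<gamma>_def by (auto simp: partition_on_def disjoint_def)
  moreover have "\<gamma> \<lesssim> (UNIV :: nat set set)"
    unfolding \<gamma>_def using image_lepoll assms by (rule lepoll_trans)
  moreover have "F (v p) = F p" if "v \<in> partition_stabilizer X \<gamma>" "p \<in> X" for v p
  proof -
    have "v ` {q \<in> X. F q = F p} = {q \<in> X. F q = F p}"
      using that by (auto simp: partition_stabilizer_def \<gamma>_def)
    then show ?thesis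
      using \<open>p \<in> X\<close> by auto
  qed
  then have "partition_stabilizer X \<gamma> \<subseteq> {v \<in> carrier (BijGroup X). \<forall>p\<in>X. F (v p) = F p}"
    by (auto simp: partition_stabilizer_def)
  ultimately show ?thesis
    unfolding identity_nhds_continuum_topology by auto
qed

lemma BijGroup_mult_apply:
  assumes "g \<in> carrier (BijGroup X)" "h \<in> carrier (BijGroup X)" "p \<in> X"
  shows "(g \<otimes>\<^bsub>BijGroup X\<^esub> h) p = g (h p)"
  using assms by (simp add: BijGroup_def compose_def)

lemma BijGroup_inv_apply:
  assumes "g \<in> carrier (BijGroup X)" "p \<in> X"
  shows "(inv\<^bsub>BijGroup X\<^esub> g) (g p) = p"
proof -
  interpret group "BijGroup X" by (rule group_BijGroup)
  have "(inv\<^bsub>BijGroup X\<^esub> g) (g p) = (inv\<^bsub>BijGroup X\<^esub> g \<otimes>\<^bsub>BijGroup X\<^esub> g) p"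
    using assms by (simp only: BijGroup_mult_apply inv_closed)
  also have "\<dots> = p"
    unfolding l_inv[OF assms(1)] using assms(2) by (simp add: BijGroup_def)
  finally show ?thesis .
qed

text \<open>The cosets are the fibres of evaluation at \<open>a\<close>: if
  \<open>h a = g a\<close>, then the inverse of \<open>g\<close> times \<open>h\<close> fixes
  \<open>a\<close>.\<close>

lemma l_coset_point_stabilizer:
  assumes "g \<in> carrier (BijGroup X)" "a \<in> X"
  shows "g <#\<^bsub>BijGroup X\<^esub> point_stabilizer X a = {h \<in> carrier (BijGroup X). h a = g a}"
proof (intro equalityI subsetI)
  interpret group "BijGroup X" by (rule group_BijGroup)
  fix h
  show "h \<in> {h \<in> carrier (BijGroup X). h a = g a}"
    if "h \<in> g <#\<^bsub>BijGroup X\<^esub> point_stabilizer X a"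
    using that assms by (auto simp: l_coset_def point_stabilizer_def BijGroup_mult_apply)
  assume h: "h \<in> {h \<in> carrier (BijGroup X). h a = g a}"
  then have "inv\<^bsub>BijGroup X\<^esub> g \<otimes>\<^bsub>BijGroup X\<^esub> h \<in> point_stabilizer X a"
    using assms by (simp add: point_stabilizer_def BijGroup_mult_apply BijGroup_inv_apply)
  moreover have "h = g \<otimes>\<^bsub>BijGroup X\<^esub> (inv\<^bsub>BijGroup X\<^esub> g \<otimes>\<^bsub>BijGroup X\<^esub> h)"
    using h assms(1) by (simp add: m_assoc[symmetric])
  ultimately show "h \<in> g <#\<^bsub>BijGroup X\<^esub> point_stabilizer X a"
    unfolding l_coset_def by blast
qed

lemma transpose_in_BijGroup:
  assumes "p \<in> X" "q \<in> X"
  shows "restrict (Transposition.transpose p q) X \<in> carrier (BijGroup X)"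
  using assms bij_betw_transpose_iff[of p X q]
  by (simp add: BijGroup_def Bij_def)

section \<open>The left quotient uniformity\<close>

text \<open>In \<open>y = x v\<close> the factor \<open>v\<close> acts on \<open>a\<close> before
  \<open>x\<close> does, so fixing the single point \<open>a\<close> already makes the two cosets
  equal.\<close>

lemma left_quotient_uniformity_discrete:
  assumes "a \<in> X"
  shows "eventually (\<lambda>(C, D). C = D)
    (left_quotient_uniformity (BijGroup X) (continuum_topology X) (point_stabilizer X a))"
proof -
  let ?G = "BijGroup X" and ?H = "point_stabilizer X a"
  interpret group ?G by (rule group_BijGroup)
  \<comment> \<open>The level sets of \<open>\<lambda>p. p = a\<close> are \<open>{a}\<close> and
    its complement: at most two blocks, and \<open>?V\<close> fixes \<open>a\<close>.\<close>
  let ?V = "{v \<in> carrier ?G. \<forall>p\<in>X. (v p = a) = (p = a)}"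
  have "infinite (UNIV :: nat set set)"
    by (simp add: Finite_Set.finite_set)
  then have "(\<lambda>p. p = a) ` X \<lesssim> (UNIV :: nat set set)"
    by (intro finite_lepoll_infinite) simp_all
  then have V: "?V \<in> identity_nhds ?G (continuum_topology X)"
    by (rule level_set_stabilizer_in_identity_nhds)
  have "x <#\<^bsub>?G\<^esub> ?H = y <#\<^bsub>?G\<^esub> ?H"
    if "x \<in> carrier ?G" "y \<in> carrier ?G" "inv\<^bsub>?G\<^esub> x \<otimes>\<^bsub>?G\<^esub> y \<in> ?V" for x y
  proof -
    let ?v = "inv\<^bsub>?G\<^esub> x \<otimes>\<^bsub>?G\<^esub> y"
    have "y = x \<otimes>\<^bsub>?G\<^esub> ?v"
      using that by (simp add: m_assoc[symmetric])
    then have "y a = x (?v a)"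
      using BijGroup_mult_apply[of x X ?v a] that assms by simp
    also have "?v a = a"
      using that(3) assms by simp
    finally show ?thesis
      using that assms by (simp add: l_coset_point_stabilizer)
  qed
  \<comment> \<open>Equality of cosets is the kernel of \<open>id\<close>, which gives the form that
    \<open>final_uniformity_le_kernel\<close> expects.\<close>
  then have "eventually (\<lambda>(x, y). id (x <#\<^bsub>?G\<^esub> ?H) = id (y <#\<^bsub>?G\<^esub> ?H))
      (left_uniformity ?G (continuum_topology X))"
    unfolding eventually_left_uniformity[OF topological_group_continuum_topology]
    using V by (intro bexI[OF _ V]) simp
  from final_uniformity_le_kernel[OF
      left_uniformity_le_principal[OF topological_group_continuum_topology]
      l_coset_funcset_lcosets this]
  show ?thesis
    by (simp add: left_quotient_uniformity_def)
qed

section \<open>The right quotient uniformity\<close>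

text \<open>In \<open>x = v y\<close> the factor \<open>v\<close> moves \<open>y a\<close>, which
  can be any point of \<open>X\<close>, so \<open>v\<close> has to preserve \<open>f\<close> over
  all of \<open>X\<close>. The bound on the range makes the level sets an admissible
  partition.\<close>

lemma right_quotient_uniformity_kernel:
  fixes f :: "('a \<Rightarrow> 'a) set \<Rightarrow> 'b"
  assumes "a \<in> X" and small: "range f \<lesssim> (UNIV :: nat set set)"
  shows "eventually (\<lambda>(C, D). f C = f D)
    (right_quotient_uniformity (BijGroup X) (continuum_topology X) (point_stabilizer X a))"
proof -
  let ?G = "BijGroup X" and ?H = "point_stabilizer X a"
  interpret group ?G by (rule group_BijGroup)
  \<comment> \<open>This is \<open>f\<close> transported to \<open>X\<close>, the point
    \<open>p\<close> standing for the coset of all \<open>g\<close> with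
    \<open>g a = p\<close>.\<close>
  define F where "F p = f {g \<in> carrier ?G. g a = p}" for p
  let ?V = "{v \<in> carrier ?G. \<forall>p\<in>X. F (v p) = F p}"
  have "F ` X \<subseteq> range f"
    by (auto simp: F_def)
  then have V: "?V \<in> identity_nhds ?G (continuum_topology X)"
    by (intro level_set_stabilizer_in_identity_nhds lepoll_trans[OF subset_imp_lepoll small])
  have "f (x <#\<^bsub>?G\<^esub> ?H) = f (y <#\<^bsub>?G\<^esub> ?H)"
    if "x \<in> carrier ?G" "y \<in> carrier ?G" "x \<otimes>\<^bsub>?G\<^esub> inv\<^bsub>?G\<^esub> y \<in> ?V" for x y
  proof -
    let ?v = "x \<otimes>\<^bsub>?G\<^esub> inv\<^bsub>?G\<^esub> y"
    have "x = ?v \<otimes>\<^bsub>?G\<^esub> y"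
      using that by (simp add: m_assoc)
    then have "x a = ?v (y a)"
      using BijGroup_mult_apply[of ?v X y a] that assms by simp
    moreover have "y a \<in> X"
      using that assms(1) by (auto simp: BijGroup_def dest: Bij_imp_funcset)
    ultimately have "F (x a) = F (y a)"
      using that(3) by simp
    then show ?thesis
      using that assms(1) by (simp add: l_coset_point_stabilizer F_def)
  qed
  then have "eventually (\<lambda>(x, y). f (x <#\<^bsub>?G\<^esub> ?H) = f (y <#\<^bsub>?G\<^esub> ?H))
      (right_uniformity ?G (continuum_topology X))"
    unfolding eventually_right_uniformity[OF topological_group_continuum_topology]
    using V by (intro bexI[OF _ V]) simp
  from final_uniformity_le_kernel[OF
      right_uniformity_le_principal[OF topological_group_continuum_topology]
      l_coset_funcset_lcosets this]
  show ?thesis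
    by (simp add: right_quotient_uniformity_def)
qed

text \<open>Otherwise sending each point to its block would inject \<open>X\<close> into
  \<open>\<gamma>\<close>.\<close>

lemma partition_on_block_two_points:
  assumes "partition_on X \<gamma>" "\<not> X \<lesssim> \<gamma>"
  obtains B p q where "B \<in> \<gamma>" "p \<in> B" "q \<in> B" "p \<noteq> q"
proof -
  have "\<forall>x\<in>X. \<exists>B\<in>\<gamma>. x \<in> B"
    using partition_onD1[OF assms(1)] by auto
  then obtain blk where blk: "\<And>x. x \<in> X \<Longrightarrow> blk x \<in> \<gamma> \<and> x \<in> blk x"
    by metis
  then have "\<not> inj_on blk X"
    using assms(2) unfolding lepoll_def by blast
  then obtain p q where "p \<in> X" "q \<in> X" "p \<noteq> q" "blk p = blk q"
    by (auto simp: inj_on_def)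
  then show thesis
    using blk that by metis
qed

text \<open>Every basic neighbourhood contains a swap of two points \<open>p\<close>,
  \<open>q\<close> of one block; carrying \<open>a\<close> to \<open>p\<close> first turns this swap
  into a pair of distinct cosets.\<close>

lemma right_quotient_uniformity_not_discrete:
  assumes "(UNIV :: nat set set) \<prec> X" "a \<in> X"
  shows "\<not> eventually (\<lambda>(C, D). C = D)
    (right_quotient_uniformity (BijGroup X) (continuum_topology X) (point_stabilizer X a))"
proof
  let ?G = "BijGroup X" and ?H = "point_stabilizer X a"
  interpret group ?G by (rule group_BijGroup)
  note top = topological_group_continuum_topology[of X]
  assume discrete: "eventually (\<lambda>(C, D). C = D) (right_quotient_uniformity ?G (continuum_topology X) ?H)"
  have "filterlim (\<lambda>(x, y). (x <#\<^bsub>?G\<^esub> ?H, y <#\<^bsub>?G\<^esub> ?H))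
      (right_quotient_uniformity ?G (continuum_topology X) ?H)
      (right_uniformity ?G (continuum_topology X))"
    using final_uniformity(2)[OF right_uniformity_le_principal[OF top]
        l_coset_funcset_lcosets[of ?G ?H]]
    by (simp add: uniformly_continuous_wrt_def right_quotient_uniformity_def)
  from eventually_compose_filterlim[OF discrete this]
  have "eventually (\<lambda>(x, y). x <#\<^bsub>?G\<^esub> ?H = y <#\<^bsub>?G\<^esub> ?H)
      (right_uniformity ?G (continuum_topology X))"
    by (simp add: case_prod_unfold)
  then obtain V where V: "V \<in> identity_nhds ?G (continuum_topology X)"
    and VE: "\<And>x y. x \<in> carrier ?G \<Longrightarrow> y \<in> carrier ?G \<Longrightarrow>
      x \<otimes>\<^bsub>?G\<^esub> inv\<^bsub>?G\<^esub> y \<in> V \<Longrightarrow> x <#\<^bsub>?G\<^esub> ?H = y <#\<^bsub>?G\<^esub> ?H"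
    unfolding eventually_right_uniformity[OF top] by auto
  obtain \<gamma> where \<gamma>: "partition_on X \<gamma>" "\<gamma> \<lesssim> (UNIV :: nat set set)"
    and \<gamma>V: "partition_stabilizer X \<gamma> \<subseteq> V"
    using V unfolding identity_nhds_continuum_topology by blast
  \<comment> \<open>An injection of \<open>X\<close> into \<open>\<gamma>\<close> would give one
    into the continuum, against strictness by Schroeder-Bernstein.\<close>
  have "\<not> X \<lesssim> \<gamma>"
    using assms(1) lepoll_trans[OF _ \<gamma>(2)] lepoll_antisym unfolding lesspoll_def by blast
  then obtain B p q where B: "B \<in> \<gamma>" "p \<in> B" "q \<in> B" "p \<noteq> q"
    using partition_on_block_two_points[OF \<gamma>(1)] by blast
  then have X: "p \<in> X" "q \<in> X"
    using partition_onD1[OF \<gamma>(1)] by auto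
  define s where "s = restrict (Transposition.transpose p q) X"
  \<comment> \<open>Since \<open>y a = p\<close> and \<open>s p = q\<close>, the cosets of
    \<open>y\<close> and of \<open>s\<close> times \<open>y\<close> correspond to \<open>p\<close>
    and \<open>q\<close>.\<close>
  define y where "y = restrict (Transposition.transpose a p) X"
  have carr: "s \<in> carrier ?G" "y \<in> carrier ?G"
    using X assms(2) by (simp_all add: s_def y_def transpose_in_BijGroup)
  have "s ` C = C" if C: "C \<in> \<gamma>" for C
  proof -
    have "C = B \<or> C \<inter> B = {}"
      using partition_onD2[OF \<gamma>(1)] C B(1) by (auto dest: disjointD)
    then have "p \<in> C \<longleftrightarrow> q \<in> C"
      using B by blast
    moreover have "C \<subseteq> X"
      using partition_onD1[OF \<gamma>(1)] C by auto
    then have "s ` C = Transposition.transpose p q ` C"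
      by (intro image_cong) (auto simp: s_def)
    ultimately show ?thesis
      by simp
  qed
  then have "s \<in> partition_stabilizer X \<gamma>"
    using carr by (simp add: partition_stabilizer_def)
  \<comment> \<open>The right difference of the pair is \<open>s\<close> itself, so the pair lies in
    the entourage of \<open>V\<close>.\<close>
  moreover have "s \<otimes>\<^bsub>?G\<^esub> y \<otimes>\<^bsub>?G\<^esub> inv\<^bsub>?G\<^esub> y = s"
    using carr by (simp add: m_assoc)
  ultimately have "(s \<otimes>\<^bsub>?G\<^esub> y) <#\<^bsub>?G\<^esub> ?H = y <#\<^bsub>?G\<^esub> ?H"
    using carr \<gamma>V by (intro VE) auto
  then have "y \<in> {h \<in> carrier ?G. h a = (s \<otimes>\<^bsub>?G\<^esub> y) a}"
    using carr assms(2) by (simp add: l_coset_point_stabilizer)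
  then have "y a = s (y a)"
    using carr assms(2) by (simp add: BijGroup_mult_apply)
  then show False
    using X B(4) assms(2) by (simp add: s_def y_def)
qed

section \<open>Comparison of the two quotient uniformities\<close>

theorem mainTheorem1:
  fixes X :: "'a set" and a :: 'a
  assumes "(UNIV :: nat set set) \<prec> X" and "a \<in> X"
  shows "(\<forall>f. left_uniformly_continuous (BijGroup X) (continuum_topology X) (point_stabilizer X a) f
            \<longrightarrow> right_uniformly_continuous (BijGroup X) (continuum_topology X) (point_stabilizer X a) f) \<and>
         (\<forall>f. right_uniformly_continuous (BijGroup X) (continuum_topology X) (point_stabilizer X a) f
            \<longrightarrow> left_uniformly_continuous (BijGroup X) (continuum_topology X) (point_stabilizer X a) f) \<and>
         left_quotient_uniformity (BijGroup X) (continuum_topology X) (point_stabilizer X a)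
           \<noteq> right_quotient_uniformity (BijGroup X) (continuum_topology X) (point_stabilizer X a)"
proof (intro conjI allI impI)
  fix f :: "('a \<Rightarrow> 'a) set \<Rightarrow> real"
  \<comment> \<open>The reals have the cardinality of the continuum, so the level sets of
    \<open>f\<close> are few enough for the topology.\<close>
  have "range f \<lesssim> (UNIV :: nat set set)"
    using subset_imp_lepoll[OF subset_UNIV] eqpoll_sym[OF nat_sets_eqpoll_reals]
    by (rule lepoll_trans2)
  then show "right_uniformly_continuous (BijGroup X) (continuum_topology X) (point_stabilizer X a) f"
    unfolding right_uniformly_continuous_def
    by (intro uniformly_continuous_wrt_kernel right_quotient_uniformity_kernel assms(2))
next
  fix f :: "('a \<Rightarrow> 'a) set \<Rightarrow> real"
  show "left_uniformly_continuous (BijGroup X) (continuum_topology X) (point_stabilizer X a) f"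
    unfolding left_uniformly_continuous_def
    by (intro uniformly_continuous_wrt_kernel
        eventually_mono[OF left_quotient_uniformity_discrete[OF assms(2)]]) auto
next
  show "left_quotient_uniformity (BijGroup X) (continuum_topology X) (point_stabilizer X a)
      \<noteq> right_quotient_uniformity (BijGroup X) (continuum_topology X) (point_stabilizer X a)"
    using left_quotient_uniformity_discrete[OF assms(2)]
      right_quotient_uniformity_not_discrete[OF assms] by metis
qed

end
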